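(* Let $k \ge 1$, let $w \in F_k$ be any group word in $k$ variables, and let $G$ be a profinite metabelian group. If $|w\{G\}| < 2^{\aleph_0}$, then the verbal subgroup $w(G)$ is finite. (That is, every group word is strongly concise in the class of profinite metabelian groups.)
   Context: A group word $w$ in $k$ variables is an element of the free group $F_k$ of rank $k$; substituting elements of a group $G$ for the variables defines the word map $w\colon G^k\to G$. The set of $w$-values is $w\{G\}=\{w(g_1,\dots,g_k)\mid g_i\in G\}$. For a profinite (topological) group $G$, the verbal subgroup $w(G)$ is the closed subgroup of $G$ generated by $w\{G\}$. A word $w$ is strongly concise in a class $\mathcal{C}$ of profinite groups if for every $G\in\mathcal{C}$ with $|w\{G\}|<2^{\aleph_0}$ the verbal subgroup $w(G)$ is finite. *)

theory Defs
  imports "HOL-Algebra.Algebra" "HOL-Analysis.Analysis"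
begin

section \<open>Free groups and word maps\<close>

text \<open>
  The letter \<open>(i, True)\<close> stands for the variable \<open>x\<^sub>i\<close> and \<open>(i, False)\<close> for its inverse;
  the variables are indexed by \<open>0, \<dots>, k - 1\<close>.  The free group of rank \<open>k\<close> is modelled
  by the freely reduced words.
\<close>

type_synonym letter = "nat \<times> bool"

definition inv_letter :: "letter \<Rightarrow> letter" where
  "inv_letter a = (fst a, \<not> snd a)"

fun reduced :: "letter list \<Rightarrow> bool" where
  "reduced [] \<longleftrightarrow> True"
| "reduced [a] \<longleftrightarrow> True"
| "reduced (a # b # w) \<longleftrightarrow> b \<noteq> inv_letter a \<and> reduced (b # w)"

text \<open>Left multiplication of a reduced word by a single letter, followed by cancellation.\<close>

fun push :: "letter \<Rightarrow> letter list \<Rightarrow> letter list" where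
  "push a [] = [a]"
| "push a (b # w) = (if b = inv_letter a then w else a # b # w)"

definition free_group :: "nat \<Rightarrow> letter list monoid" where
  "free_group k =
     \<lparr> carrier = {w. reduced w \<and> (\<forall>a \<in> set w. fst a < k)},
       monoid.mult = (\<lambda>u v. foldr push u v),
       monoid.one = [] \<rparr>"

definition letter_val :: "('a, 'b) monoid_scheme \<Rightarrow> (nat \<Rightarrow> 'a) \<Rightarrow> letter \<Rightarrow> 'a" where
  "letter_val G g a = (if snd a then g (fst a) else inv\<^bsub>G\<^esub> g (fst a))"

definition word_map :: "('a, 'b) monoid_scheme \<Rightarrow> letter list \<Rightarrow> (nat \<Rightarrow> 'a) \<Rightarrow> 'a" where
  "word_map G w g = foldr (\<lambda>a x. letter_val G g a \<otimes>\<^bsub>G\<^esub> x) w \<one>\<^bsub>G\<^esub>"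

definition word_values :: "('a, 'b) monoid_scheme \<Rightarrow> nat \<Rightarrow> letter list \<Rightarrow> 'a set" where
  "word_values G k w = word_map G w ` ({..<k} \<rightarrow>\<^sub>E carrier G)"

text \<open>
  The reduced words form a group, and substituting elements of a group \<open>G\<close> is the
  homomorphism to \<open>G\<close> that sends each variable to the element substituted for it.
\<close>

lemma inv_letter_inv_letter [simp]: "inv_letter (inv_letter a) = a"
  by (simp add: inv_letter_def)

lemma inv_letter_neq [simp]: "inv_letter a \<noteq> a"
  by (cases a) (auto simp: inv_letter_def)

lemma fst_inv_letter [simp]: "fst (inv_letter a) = fst a"
  by (simp add: inv_letter_def)

lemma reduced_ConsD: "reduced (a # w) \<Longrightarrow> reduced w"
  by (cases w) auto

lemma reduced_push: "reduced w \<Longrightarrow> reduced (push a w)"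
  by (cases w) (auto dest: reduced_ConsD)

lemma reduced_foldr_push: "reduced w \<Longrightarrow> reduced (foldr push u w)"
  by (induction u) (auto intro: reduced_push)

lemma set_push: "set (push a w) \<subseteq> insert a (set w)"
  by (cases w) auto

lemma set_foldr_push: "set (foldr push u w) \<subseteq> set u \<union> set w"
  by (induction u) (use set_push in fastforce)+

lemma push_push_inv: "reduced w \<Longrightarrow> push a (push (inv_letter a) w) = w"
  by (cases w rule: reduced.cases) auto

lemma foldr_push_push:
  assumes "reduced w"
  shows "foldr push (push a v) w = push a (foldr push v w)"
proof (cases v)
  case (Cons b v')
  show ?thesis
    using push_push_inv[OF reduced_foldr_push[OF assms, of v'], of a] Cons by auto
qed auto

lemma foldr_push_assoc:
  assumes "reduced w"
  shows "foldr push (foldr push u v) w = foldr push u (foldr push v w)"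
  by (induction u) (simp_all add: foldr_push_push[OF assms])

lemma foldr_push_Nil: "reduced u \<Longrightarrow> foldr push u [] = u"
  by (induction u rule: reduced.induct) auto

lemma foldr_push_left_inverse:
  assumes "reduced w"
  shows "foldr push (rev (map inv_letter u)) (foldr push u w) = w"
  using assms
proof (induction u arbitrary: w)
  case (Cons a u)
  have "reduced (foldr push u w)"
    using Cons.prems by (rule reduced_foldr_push)
  from push_push_inv[OF this, of "inv_letter a"] show ?case
    using Cons by simp
qed simp

lemma free_group_is_group: "group (free_group k)"
proof (rule groupI)
  fix u assume u: "u \<in> carrier (free_group k)"
  let ?v = "foldr push (rev (map inv_letter u)) []"
  have "reduced ?v"
    by (rule reduced_foldr_push) simp
  moreover have "\<forall>a \<in> set ?v. fst a < k"
  proof -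
    have "\<forall>a \<in> set (rev (map inv_letter u)). fst a < k"
      using u by (simp add: free_group_def)
    then show ?thesis
      using set_foldr_push[of "rev (map inv_letter u)" "[]"]
      unfolding list.set(1) Un_empty_right by blast
  qed
  moreover have "foldr push ?v u = []"
    using u foldr_push_assoc[of u "rev (map inv_letter u)" "[]"]
      foldr_push_left_inverse[of "[]" u] foldr_push_Nil[of u]
    by (simp add: free_group_def)
  ultimately show "\<exists>v \<in> carrier (free_group k). v \<otimes>\<^bsub>free_group k\<^esub> u = \<one>\<^bsub>free_group k\<^esub>"
    by (intro bexI[of _ ?v]) (simp_all add: free_group_def)
next
  fix u v assume "u \<in> carrier (free_group k)" "v \<in> carrier (free_group k)"
  then show "u \<otimes>\<^bsub>free_group k\<^esub> v \<in> carrier (free_group k)"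
    using set_foldr_push[of u v]
    by (fastforce simp: free_group_def intro: reduced_foldr_push)
qed (simp_all add: free_group_def foldr_push_assoc)

lemma letter_val_closed:
  assumes "group G" "g \<in> {..<k} \<rightarrow> carrier G" "fst a < k"
  shows "letter_val G g a \<in> carrier G"
  using assms by (auto simp: letter_val_def intro!: group.inv_closed)

lemma word_map_closed:
  assumes "group G" "g \<in> {..<k} \<rightarrow> carrier G" "\<forall>a \<in> set w. fst a < k"
  shows "word_map G w g \<in> carrier G"
proof -
  interpret group G by fact
  show ?thesis
    using assms(3)
    by (induction w) (auto simp: word_map_def intro!: letter_val_closed[OF assms(1,2)])
qed

lemma word_map_push:
  assumes "group G" "g \<in> {..<k} \<rightarrow> carrier G" "fst a < k" "\<forall>b \<in> set w. fst b < k"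
  shows "word_map G (push a w) g = letter_val G g a \<otimes>\<^bsub>G\<^esub> word_map G w g"
proof -
  interpret group G by fact
  show ?thesis
  proof (cases "\<exists>v. w = inv_letter a # v")
    case True
    then obtain v where w: "w = inv_letter a # v" by blast
    have v: "word_map G v g \<in> carrier G"
      using assms w by (intro word_map_closed) auto
    have g: "g (fst a) \<in> carrier G"
      using assms by auto
    have "word_map G w g = letter_val G g (inv_letter a) \<otimes>\<^bsub>G\<^esub> word_map G v g"
      by (simp add: w word_map_def)
    then show ?thesis
      using v g by (auto simp: w letter_val_def inv_letter_def m_assoc[symmetric])
  next
    case False
    then have "push a w = a # w"
      by (cases w) auto
    then show ?thesis
      by (simp add: word_map_def)
  qed
qed

lemma word_map_hom:
  assumes "group G" "g \<in> {..<k} \<rightarrow> carrier G"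
  shows "(\<lambda>w. word_map G w g) \<in> hom (free_group k) G"
proof (rule homI)
  fix u assume "u \<in> carrier (free_group k)"
  then show "word_map G u g \<in> carrier G"
    by (intro word_map_closed[OF assms]) (simp add: free_group_def)
next
  interpret group G by fact
  fix u v assume uv: "u \<in> carrier (free_group k)" "v \<in> carrier (free_group k)"
  have v: "\<forall>a \<in> set v. fst a < k"
    using uv by (simp add: free_group_def)
  have "\<forall>a \<in> set u. fst a < k"
    using uv by (simp add: free_group_def)
  then have "word_map G (foldr push u v) g = word_map G u g \<otimes>\<^bsub>G\<^esub> word_map G v g"
  proof (induction u)
    case Nil
    show ?case
      using word_map_closed[OF assms v] by (simp add: word_map_def)
  next
    case (Cons a u)
    have uv': "\<forall>b \<in> set (foldr push u v). fst b < k"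
      using Cons.prems v set_foldr_push[of u v] by fastforce
    have "word_map G (foldr push (a # u) v) g
        = letter_val G g a \<otimes>\<^bsub>G\<^esub> (word_map G u g \<otimes>\<^bsub>G\<^esub> word_map G v g)"
      using Cons word_map_push[OF assms _ uv'] by simp
    also have "\<dots> = (letter_val G g a \<otimes>\<^bsub>G\<^esub> word_map G u g) \<otimes>\<^bsub>G\<^esub> word_map G v g"
      using Cons.prems v
      by (intro m_assoc[symmetric] letter_val_closed[OF assms] word_map_closed[OF assms]) auto
    finally show ?case
      by (simp add: word_map_def)
  qed
  then show "word_map G (u \<otimes>\<^bsub>free_group k\<^esub> v) g = word_map G u g \<otimes>\<^bsub>G\<^esub> word_map G v g"
    by (simp add: free_group_def)
qed

lemma word_map_variable:
  assumes "group G" "g \<in> {..<k} \<rightarrow> carrier G" "i < k"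
  shows "word_map G [(i, True)] g = g i"
proof -
  interpret group G by fact
  from assms have "g i \<in> carrier G"
    by auto
  then show ?thesis
    by (simp add: word_map_def letter_val_def)
qed


section \<open>Profinite groups and verbal subgroups\<close>

locale topological_group = group G for G :: "('a, 'b) monoid_scheme" (structure) +
  fixes T :: "'a topology"
  assumes topspace_eq: "topspace T = carrier G"
    and continuous_mult: "continuous_map (prod_topology T T) T (\<lambda>(x, y). x \<otimes> y)"
    and continuous_inv: "continuous_map T T (\<lambda>x. inv x)"

definition totally_disconnected_space :: "'a topology \<Rightarrow> bool" where
  "totally_disconnected_space T \<longleftrightarrow>
     (\<forall>x \<in> topspace T. connected_component_of_set T x = {x})"

locale profinite_group = topological_group +
  assumes compact: "compact_space T"
    and hausdorff: "Hausdorff_space T"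
    and totally_disconnected: "totally_disconnected_space T"

text \<open>
  The second derived subgroup is trivial.  This is the abstract derived series; in a
  Hausdorff topological group, using closures of the commutator subgroups instead gives
  the same class of groups.
\<close>

definition metabelian :: "('a, 'b) monoid_scheme \<Rightarrow> bool" where
  "metabelian G \<longleftrightarrow> group G \<and> derived G (derived G (carrier G)) = {\<one>\<^bsub>G\<^esub>}"

definition closed_subgroup_generated ::
    "('a, 'b) monoid_scheme \<Rightarrow> 'a topology \<Rightarrow> 'a set \<Rightarrow> 'a set" where
  "closed_subgroup_generated G T S = \<Inter>{H. subgroup H G \<and> closedin T H \<and> S \<subseteq> H}"

definition verbal_subgroup ::
    "('a, 'b) monoid_scheme \<Rightarrow> 'a topology \<Rightarrow> nat \<Rightarrow> letter list \<Rightarrow> 'a set" where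
  "verbal_subgroup G T k w = closed_subgroup_generated G T (word_values G k w)"

end

theory Submission
  imports Defs
begin

text \<open>
  Let \<open>A\<close> be the derived subgroup of the metabelian group \<open>G\<close>.  It is abelian and normal, and
  since \<open>G/A\<close> is abelian, conjugation makes \<open>A\<close> a module on which the operators coming from
  \<open>G\<close> commute with each other.  Write \<open>xu\<close> for the pointwise product of two assignments of
  elements of \<open>G\<close> to the variables.  A word map is multiplicative modulo \<open>A\<close>, so its failure to
  be multiplicative, the defect \<open>w(xu) w(u)\<inverse> w(x)\<inverse>\<close>, lies in \<open>A\<close>.  The point of the proof is
  that for fixed \<open>x\<close> the defect is an exponential polynomial in \<open>u\<close>: every word \<open>m\<close> gives
  a character \<open>u \<mapsto> m(u)\<close> with values in the commuting operators on \<open>A\<close>, and the defect is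
  killed by a finite product of twisted differences
  \<open>f \<mapsto> (u \<mapsto> f(xu) - m(x) \<cdot> f(u))\<close>, one for each word of a finite list; the shifts \<open>x\<close> may be
  chosen afresh at every factor (\<open>defect_annihilated\<close>).  This is used twice.

  \<^emph>\<open>Few values are finitely many.\<close>  A nonempty compact Hausdorff space with fewer than \<open>2\<close> to the
  \<open>\<aleph>\<^sub>0\<close> points cannot be perfect, so a continuous function on a compact space with that
  few values has an isolated value and is therefore locally constant at some point.  If \<open>f\<close> is such
  a function and each of its twisted differences is locally constant, then
  \<open>f(xu) = m(x) \<cdot> f(u) + locally constant\<close> carries local constancy from that one
  point to every other point.  Induction on the number of twisted differences
  (\<open>annihilated_small_locally_constant\<close>) makes the defects locally constant, the same
  argument then makes \<open>w\<close> locally constant, and compactness leaves only finitely many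
  values (\<open>small_values_finite\<close>).

  \<^emph>\<open>Finitely many values generate a finite group.\<close>  By Dietzmann's lemma it suffices that every value
  is a torsion element, because the values are closed under conjugation.  Where the characters act
  trivially modulo torsion, an exponential polynomial is an ordinary polynomial modulo torsion,
  and a polynomial with finitely many values is constant modulo torsion
  (\<open>annihilated_finite_invariant\<close>).  This applies first to assignments in \<open>A\<close>, which act
  trivially on \<open>A\<close>, and shows that \<open>w(xa)\<close> and \<open>w(x)\<close> agree modulo torsion for
  \<open>a\<close> in \<open>A\<close>; since conjugating \<open>x\<close> multiplies it by elements of \<open>A\<close>, the values of
  \<open>w\<close> are central modulo torsion.  Hence it applies next to all assignments and shows that all
  defects are torsion.  So \<open>w\<close> is multiplicative modulo torsion, and the finitely many values
  \<open>w(x), w(x\<^sup>2), w(x\<^sup>3), \<dots>\<close> force a power of \<open>w(x)\<close> to be torsion.  The finite group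
  generated by the values is closed, so it contains the verbal subgroup.
\<close>

section \<open>Finite normal sets of torsion elements\<close>

context group
begin

definition conj_by :: "'a \<Rightarrow> 'a \<Rightarrow> 'a" where
  "conj_by g x = g \<otimes> x \<otimes> inv g"

definition list_prod :: "'a list \<Rightarrow> 'a" where
  "list_prod xs = foldr (\<otimes>) xs \<one>"

lemma mult_inv_cancel [simp]:
  assumes "x \<in> carrier G" "y \<in> carrier G"
  shows "x \<otimes> (inv x \<otimes> y) = y" "inv x \<otimes> (x \<otimes> y) = y"
  using assms by (simp_all add: m_assoc[symmetric])

lemma conj_by_closed [simp]: "g \<in> carrier G \<Longrightarrow> x \<in> carrier G \<Longrightarrow> conj_by g x \<in> carrier G"
  by (simp add: conj_by_def)

lemma conj_by_one [simp]: "x \<in> carrier G \<Longrightarrow> conj_by \<one> x = x" "g \<in> carrier G \<Longrightarrow> conj_by g \<one> = \<one>"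
  by (simp_all add: conj_by_def)

lemma conj_by_mult:
  "g \<in> carrier G \<Longrightarrow> x \<in> carrier G \<Longrightarrow> y \<in> carrier G \<Longrightarrow> conj_by g (x \<otimes> y) = conj_by g x \<otimes> conj_by g y"
  by (simp add: conj_by_def m_assoc)

lemma conj_by_inv: "g \<in> carrier G \<Longrightarrow> x \<in> carrier G \<Longrightarrow> conj_by g (inv x) = inv (conj_by g x)"
  by (simp add: conj_by_def m_assoc inv_mult_group)

lemma conj_by_conj_by:
  "g \<in> carrier G \<Longrightarrow> h \<in> carrier G \<Longrightarrow> x \<in> carrier G \<Longrightarrow> conj_by g (conj_by h x) = conj_by (g \<otimes> h) x"
  by (simp add: conj_by_def m_assoc inv_mult_group)

lemma conj_by_pow:
  fixes n :: nat
  shows "g \<in> carrier G \<Longrightarrow> x \<in> carrier G \<Longrightarrow> conj_by g (x [^] n) = conj_by g x [^] n"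
  by (induction n) (simp_all add: conj_by_mult)

lemma list_prod_simps [simp]:
  "list_prod [] = \<one>" "list_prod (x # xs) = x \<otimes> list_prod xs"
  by (simp_all add: list_prod_def)

lemma list_prod_closed [simp]: "set xs \<subseteq> carrier G \<Longrightarrow> list_prod xs \<in> carrier G"
  by (induction xs) auto

lemma list_prod_append:
  "set xs \<subseteq> carrier G \<Longrightarrow> set ys \<subseteq> carrier G \<Longrightarrow> list_prod (xs @ ys) = list_prod xs \<otimes> list_prod ys"
  by (induction xs) (auto simp: m_assoc)

lemma list_prod_replicate: "x \<in> carrier G \<Longrightarrow> list_prod (replicate n x) = x [^] n"
proof (induction n)
  case (Suc n)
  then show ?case
    using nat_pow_Suc2[of x n] by (simp del: nat_pow_Suc)
qed simp

text \<open>
  The factors equal to \<open>x\<close> can be moved to the front: moving \<open>x\<close> leftwards past a factor \<open>z\<close>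
  replaces \<open>z\<close> by a conjugate, which is again in \<open>V\<close>, and does not change the number of
  factors.
\<close>

lemma list_prod_collect:
  assumes V: "V \<subseteq> carrier G" "\<And>x y. x \<in> V \<Longrightarrow> y \<in> V \<Longrightarrow> conj_by x y \<in> V"
    and inv: "\<And>x. x \<in> V \<Longrightarrow> inv x \<in> V"
    and x: "x \<in> V" and xs: "set xs \<subseteq> V"
  shows "\<exists>ys. set ys \<subseteq> V \<and> length ys + count_list xs x = length xs
           \<and> list_prod xs = x [^] count_list xs x \<otimes> list_prod ys"
  using xs
proof (induction xs)
  case (Cons z zs)
  then obtain ys where ys: "set ys \<subseteq> V" "length ys + count_list zs x = length zs"
    "list_prod zs = x [^] count_list zs x \<otimes> list_prod ys"
    by auto
  have c: "x \<in> carrier G" "z \<in> carrier G" "list_prod ys \<in> carrier G"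
    using V x ys Cons.prems by auto
  show ?case
  proof (cases "z = x")
    case True
    then have "list_prod (z # zs) = x [^] count_list (z # zs) x \<otimes> list_prod ys"
      using ys c nat_pow_Suc2[of x "count_list zs x"] by (simp add: m_assoc[symmetric] del: nat_pow_Suc)
    then show ?thesis
      using ys True by (intro exI[of _ ys]) simp
  next
    case False
    have pow: "conj_by (inv x [^] n) z \<in> V" for n :: nat
    proof (induction n)
      case (Suc n)
      have "conj_by (inv x [^] Suc n) z = conj_by (inv x) (conj_by (inv x [^] n) z)"
        using c nat_pow_Suc2[of "inv x" n] by (simp add: conj_by_conj_by del: nat_pow_Suc)
      then show ?case
        using V(2)[OF inv[OF x] Suc.IH] by simp
    qed (use Cons.prems c in auto)
    let ?n = "count_list zs x"
    have "list_prod (z # zs) = x [^] ?n \<otimes> list_prod (conj_by (inv x [^] ?n) z # ys)"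
      using ys(3) c by (simp add: conj_by_def m_assoc nat_pow_inv)
    then show ?thesis
      using ys False pow[of ?n] by (intro exI[of _ "conj_by (inv x [^] ?n) z # ys"]) simp
  qed
qed auto

lemma common_torsion_exponent:
  assumes "finite V" "\<And>x. x \<in> V \<Longrightarrow> x \<in> carrier G \<and> (\<exists>n>0::nat. x [^] n = \<one>)"
  shows "\<exists>e>0::nat. \<forall>x\<in>V. x [^] e = \<one>"
  using assms
proof (induction V rule: finite_induct)
  case (insert x V)
  then obtain e n :: nat where e: "e > 0" "\<forall>x\<in>V. x [^] e = \<one>" and n: "n > 0" "x [^] n = \<one>"
    by (metis insert_iff)
  have "y [^] (n * e) = \<one>" if "y \<in> insert x V" for y
    using that e n insert.prems nat_pow_pow[of y n e] nat_pow_pow[of y e n]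
    by (auto simp: mult.commute)
  then show ?case
    using e n by (intro exI[of _ "n * e"]) auto
qed auto

text \<open>
  If \<open>e\<close> is a common exponent, then among more than \<open>card Y * e\<close> factors from \<open>Y\<close> one element
  \<open>x\<close> occurs at least \<open>e\<close> times; collecting these occurrences and using \<open>x\<^sup>e = 1\<close> gives a
  shorter product.  So products of bounded length already give the whole subgroup.
\<close>

theorem Dietzmann:
  assumes fin: "finite V"
    and normal: "\<And>g x. g \<in> carrier G \<Longrightarrow> x \<in> V \<Longrightarrow> conj_by g x \<in> V"
    and torsion: "\<And>x. x \<in> V \<Longrightarrow> x \<in> carrier G \<and> (\<exists>n>0::nat. x [^] n = \<one>)"
  shows "finite (generate G V)"
proof -
  define Y where "Y = V \<union> m_inv G ` V"
  have XG: "V \<subseteq> carrier G"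
    using torsion by auto
  have Y: "finite Y" "Y \<subseteq> carrier G"
    using fin XG by (auto simp: Y_def)
  have invY: "inv y \<in> Y" if "y \<in> Y" for y
    using that XG by (auto simp: Y_def)
  have conjY: "conj_by x y \<in> Y" if "x \<in> Y" "y \<in> Y" for x y
    using that Y(2) XG normal by (auto simp: Y_def subset_iff conj_by_inv)
  obtain e :: nat where e: "e > 0" "\<forall>x\<in>V. x [^] e = \<one>"
    using common_torsion_exponent[OF fin torsion] by blast
  have eY: "y [^] e = \<one>" if "y \<in> Y" for y
    using that e XG by (auto simp: Y_def nat_pow_inv subset_iff)
  define L where "L = card Y * e"
  have shorten: "\<exists>ys. set ys \<subseteq> Y \<and> length ys \<le> L \<and> list_prod ys = list_prod xs" if "set xs \<subseteq> Y" for xs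
    using that
  proof (induction "length xs" arbitrary: xs rule: less_induct)
    case less
    show ?case
    proof (cases "length xs \<le> L")
      case False
      have "\<exists>x\<in>set xs. count_list xs x \<ge> e"
      proof (rule ccontr)
        assume "\<not> (\<exists>x\<in>set xs. count_list xs x \<ge> e)"
        then have "sum (count_list xs) (set xs) \<le> card (set xs) * e"
          using sum_bounded_above[of "set xs" "count_list xs" e] by (force simp: not_le)
        also have "\<dots> \<le> L"
          using less.prems Y by (simp add: L_def card_mono)
        finally show False
          using False sum_count_set[of xs "set xs"] by simp
      qed
      then obtain x where x: "x \<in> set xs" "count_list xs x \<ge> e"
        by blast
      then have xY: "x \<in> Y" and xG: "x \<in> carrier G"
        using less.prems Y by auto
      obtain ys where ys: "set ys \<subseteq> Y" "length ys + count_list xs x = length xs"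
        "list_prod xs = x [^] count_list xs x \<otimes> list_prod ys"
        using list_prod_collect[OF Y(2) conjY invY xY less.prems] by blast
      let ?c = "count_list xs x"
      let ?zs = "replicate (?c - e) x @ ys"
      have "x [^] ?c = x [^] e \<otimes> x [^] (?c - e)"
        using x(2) xG by (simp add: nat_pow_mult)
      then have "list_prod ?zs = list_prod xs"
        using xG ys Y eY[OF xY] by (subst list_prod_append) (auto simp: list_prod_replicate)
      moreover have "set ?zs \<subseteq> Y"
        using xY ys by auto
      moreover have "length ?zs < length xs"
        using ys x e by simp
      ultimately show ?thesis
        using less.hyps[of ?zs] by auto
    qed (use less.prems in blast)
  qed
  have "generate G V \<subseteq> list_prod ` {ys. set ys \<subseteq> Y \<and> length ys \<le> L}"
  proof
    fix g assume "g \<in> generate G V"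
    then have "\<exists>ys. set ys \<subseteq> Y \<and> list_prod ys = g"
    proof (induction rule: generate.induct)
      case one
      then show ?case by (intro exI[of _ "[]"]) simp
    next
      case (incl h)
      then show ?case using XG by (intro exI[of _ "[h]"]) (auto simp: Y_def)
    next
      case (inv h)
      then show ?case using XG by (intro exI[of _ "[inv h]"]) (auto simp: Y_def)
    next
      case (eng h1 h2)
      then obtain ys zs where "set ys \<subseteq> Y" "list_prod ys = h1" "set zs \<subseteq> Y" "list_prod zs = h2"
        by auto
      then show ?case
        using Y(2) list_prod_append[of ys zs] by (intro exI[of _ "ys @ zs"]) auto
    qed
    then show "g \<in> list_prod ` {ys. set ys \<subseteq> Y \<and> length ys \<le> L}"
      using shorten by (smt (verit) image_eqI mem_Collect_eq)
  qed
  then show ?thesis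
    using finite_lists_length_le[OF Y(1), of L] finite_surj by blast
qed

end

section \<open>Words\<close>

context group
begin

text \<open>
  All variables receive a value, not only the first \<open>k\<close>.  Assignments then form a group under
  pointwise multiplication without restrictions of functions, and the product topology on them is
  still compact.
\<close>

definition assignments :: "(nat \<Rightarrow> 'a) set" (\<open>\<Gamma>\<close>) where
  "\<Gamma> = (UNIV \<rightarrow> carrier G)"

definition shift :: "(nat \<Rightarrow> 'a) \<Rightarrow> (nat \<Rightarrow> 'a) \<Rightarrow> nat \<Rightarrow> 'a" where
  "shift x u = (\<lambda>i. x i \<otimes> u i)"

abbreviation val :: "letter list \<Rightarrow> (nat \<Rightarrow> 'a) \<Rightarrow> 'a" where
  "val \<equiv> word_map G"

definition defect :: "letter list \<Rightarrow> (nat \<Rightarrow> 'a) \<Rightarrow> (nat \<Rightarrow> 'a) \<Rightarrow> 'a" where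
  "defect w x u = val w (shift x u) \<otimes> inv (val w u) \<otimes> inv (val w x)"

lemma assignment_closed [simp]: "u \<in> \<Gamma> \<Longrightarrow> u i \<in> carrier G"
  by (auto simp: assignments_def)

lemma assignmentI: "(\<And>i. u i \<in> carrier G) \<Longrightarrow> u \<in> \<Gamma>"
  by (auto simp: assignments_def)

lemma shift_closed [simp]: "x \<in> \<Gamma> \<Longrightarrow> u \<in> \<Gamma> \<Longrightarrow> shift x u \<in> \<Gamma>"
  by (rule assignmentI) (simp add: shift_def)

lemma shift_assoc:
  "x \<in> \<Gamma> \<Longrightarrow> y \<in> \<Gamma> \<Longrightarrow> u \<in> \<Gamma> \<Longrightarrow> shift (shift x y) u = shift x (shift y u)"
  by (simp add: shift_def m_assoc)

lemma letter_val_assignment_closed [simp]: "u \<in> \<Gamma> \<Longrightarrow> letter_val G u y \<in> carrier G"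
  by (simp add: letter_val_def)

lemma val_Nil [simp]: "val [] u = \<one>"
  by (simp add: word_map_def)

lemma val_Cons [simp]: "val (y # w) u = letter_val G u y \<otimes> val w u"
  by (simp add: word_map_def)

lemma val_closed [simp]: "u \<in> \<Gamma> \<Longrightarrow> val w u \<in> carrier G"
  by (induction w) simp_all

lemma val_append: "u \<in> \<Gamma> \<Longrightarrow> val (v @ w) u = val v u \<otimes> val w u"
  by (induction v) (simp_all add: m_assoc)

lemma letter_val_shift:
  "x \<in> \<Gamma> \<Longrightarrow> u \<in> \<Gamma> \<Longrightarrow> letter_val G (shift x u) y =
     (if snd y then letter_val G x y \<otimes> letter_val G u y else letter_val G u y \<otimes> letter_val G x y)"
  by (simp add: letter_val_def shift_def inv_mult_group)

lemma val_shift: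
  "x \<in> \<Gamma> \<Longrightarrow> u \<in> \<Gamma> \<Longrightarrow> val w (shift x u) = defect w x u \<otimes> val w x \<otimes> val w u"
  by (simp add: defect_def m_assoc)

lemma defect_closed [simp]: "x \<in> \<Gamma> \<Longrightarrow> u \<in> \<Gamma> \<Longrightarrow> defect w x u \<in> carrier G"
  by (simp add: defect_def)

text \<open>
  The recursion that drives the analysis of word maps: a new first letter \<open>Y\<close> contributes the old
  defect twisted by \<open>Y\<close>, the defect of the letter itself, and a commutator of \<open>Y u\<close> with
  a constant.
\<close>

lemma defect_Cons:
  fixes y :: letter
  assumes "x \<in> \<Gamma>" "u \<in> \<Gamma>"
  defines "Y \<equiv> \<lambda>v. letter_val G v y"
  shows "defect (y # w) x u =
    conj_by (Y (shift x u)) (defect w x u)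
    \<otimes> (Y (shift x u) \<otimes> inv (Y u) \<otimes> inv (Y x))
    \<otimes> conj_by (Y x) (Y u \<otimes> val w x \<otimes> inv (Y u) \<otimes> inv (val w x))"
  using assms(1,2) unfolding defect_def conj_by_def Y_def
  by (simp add: m_assoc inv_mult_group)

lemma conj_by_val:
  assumes "g \<in> carrier G" "u \<in> \<Gamma>"
  shows "val w (\<lambda>i. conj_by g (u i)) = conj_by g (val w u)"
  using assms
  by (induction w) (simp_all add: conj_by_mult letter_val_def conj_by_inv)

end

section \<open>Abelian-by-abelian groups\<close>

text \<open>
  The abstract derived subgroup of a metabelian group is an example of \<open>A\<close>.  It may fail to be
  closed; the compactness arguments below therefore take place in \<open>G\<close>.
\<close>

locale abelian_by_abelian = group G for G :: "('a, 'b) monoid_scheme" (structure) +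
  fixes A :: "'a set"
  assumes normal_A: "A \<lhd> G"
    and A_commute: "a \<in> A \<Longrightarrow> b \<in> A \<Longrightarrow> a \<otimes> b = b \<otimes> a"
    and commutator_in_A: "g \<in> carrier G \<Longrightarrow> h \<in> carrier G \<Longrightarrow> g \<otimes> h \<otimes> inv g \<otimes> inv h \<in> A"
begin

lemma subgroup_A: "subgroup A G"
  using normal_A by (rule normal_imp_subgroup)

lemma A_closed [simp]: "a \<in> A \<Longrightarrow> a \<in> carrier G"
  using subgroup.mem_carrier[OF subgroup_A] .

lemma one_in_A [simp]: "\<one> \<in> A"
  using subgroup.one_closed[OF subgroup_A] .

lemma mult_in_A [simp]: "a \<in> A \<Longrightarrow> b \<in> A \<Longrightarrow> a \<otimes> b \<in> A"
  using subgroup.m_closed[OF subgroup_A] .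

lemma inv_in_A [simp]: "a \<in> A \<Longrightarrow> inv a \<in> A"
  using subgroup.m_inv_closed[OF subgroup_A] .

lemma conj_by_in_A [simp]: "g \<in> carrier G \<Longrightarrow> a \<in> A \<Longrightarrow> conj_by g a \<in> A"
  unfolding conj_by_def using normal.inv_op_closed2[OF normal_A] .

lemma A_div_mult:
  assumes "a \<in> A" "b \<in> A" "c \<in> A" "d \<in> A"
  shows "(a \<otimes> b) \<otimes> inv (c \<otimes> d) = (a \<otimes> inv c) \<otimes> (b \<otimes> inv d)"
  using assms A_commute[of "b \<otimes> inv d" "inv c"] by (simp add: m_assoc inv_mult_group)

lemma inv_mult_A: "a \<in> A \<Longrightarrow> b \<in> A \<Longrightarrow> inv (a \<otimes> b) = inv a \<otimes> inv b"
  using A_commute[of "inv a" "inv b"] by (simp add: inv_mult_group)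

text \<open>
  The action on \<open>A\<close> by conjugation factors through the abelian group \<open>G/A\<close>, since \<open>A\<close> acts
  trivially on itself.
\<close>

lemma conj_by_mod_A:
  assumes "g \<in> carrier G" "h \<in> carrier G" "g \<otimes> inv h \<in> A" "a \<in> A"
  shows "conj_by g a = conj_by h a"
proof -
  have "conj_by g a = conj_by (g \<otimes> inv h) (conj_by h a)"
    using assms by (simp add: conj_by_conj_by m_assoc)
  also have "\<dots> = conj_by h a"
    using assms A_commute[of "g \<otimes> inv h" "conj_by h a"]
    unfolding conj_by_def[of "g \<otimes> inv h"] by (simp add: m_assoc)
  finally show ?thesis .
qed

lemma conj_by_commute:
  assumes "g \<in> carrier G" "h \<in> carrier G" "a \<in> A"
  shows "conj_by g (conj_by h a) = conj_by h (conj_by g a)"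
  using assms conj_by_mod_A[of "g \<otimes> h" "h \<otimes> g" a] commutator_in_A[of g h]
  by (simp add: conj_by_conj_by inv_mult_group m_assoc)

lemma defect_in_A: "x \<in> \<Gamma> \<Longrightarrow> u \<in> \<Gamma> \<Longrightarrow> defect w x u \<in> A"
proof (induction w)
  case (Cons y w)
  have "letter_val G (shift x u) y \<otimes> inv (letter_val G u y) \<otimes> inv (letter_val G x y) \<in> A"
    using Cons.prems commutator_in_A[of "letter_val G u y" "letter_val G x y"]
    by (simp add: letter_val_shift m_assoc)
  then show ?case
    using Cons commutator_in_A by (simp add: defect_Cons)
qed (simp add: defect_def)

text \<open>
  Word maps are characters: as operators on \<open>A\<close>, their values are multiplicative in the assignment.
\<close>

lemma conj_by_val_shift:
  assumes "x \<in> \<Gamma>" "u \<in> \<Gamma>" "a \<in> A"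
  shows "conj_by (val m (shift x u)) a = conj_by (val m x) (conj_by (val m u) a)"
proof -
  have "conj_by (val m (shift x u)) a = conj_by (val m x \<otimes> val m u) a"
    using assms defect_in_A[of x u m] by (intro conj_by_mod_A) (simp_all add: defect_def inv_mult_group m_assoc)
  then show ?thesis
    using assms by (simp add: conj_by_conj_by)
qed

section \<open>Exponential polynomials\<close>

text \<open>
  In additive notation for \<open>A\<close> this is \<open>f(xu) - m(x) \<cdot> f(u)\<close>.  It kills the monomial
  \<open>u \<mapsto> m(u) \<cdot> b\<close>, just as an ordinary difference kills a constant.
\<close>

definition twisted_diff :: "letter list \<Rightarrow> (nat \<Rightarrow> 'a) \<Rightarrow> ((nat \<Rightarrow> 'a) \<Rightarrow> 'a) \<Rightarrow> (nat \<Rightarrow> 'a) \<Rightarrow> 'a" where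
  "twisted_diff m x f = (\<lambda>u. f (shift x u) \<otimes> inv (conj_by (val m x) (f u)))"

text \<open>
  The characters are fixed in advance, but the shift \<open>x\<close> may depend on what was chosen before.  With
  the list of words fixed, the functions that are annihilated form a module, which a mere bound on the
  number of differences would not give.
\<close>

primrec annihilated :: "letter list list \<Rightarrow> ((nat \<Rightarrow> 'a) \<Rightarrow> 'a) \<Rightarrow> bool" where
  "annihilated [] f \<longleftrightarrow> (\<forall>u\<in>\<Gamma>. f u = \<one>)"
| "annihilated (m # ms) f \<longleftrightarrow> (\<forall>x\<in>\<Gamma>. annihilated ms (twisted_diff m x f))"

lemma annihilated_cong:
  assumes "\<And>u. u \<in> \<Gamma> \<Longrightarrow> f u = g u"
  shows "annihilated ms f \<longleftrightarrow> annihilated ms g"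
  using assms
proof (induction ms arbitrary: f g)
  case (Cons m ms)
  have "annihilated ms (twisted_diff m x f) \<longleftrightarrow> annihilated ms (twisted_diff m x g)" if "x \<in> \<Gamma>" for x
    using that Cons.prems by (intro Cons.IH) (simp add: twisted_diff_def)
  then show ?case
    by simp
qed simp

lemma mult_funcset_A: "f \<in> \<Gamma> \<rightarrow> A \<Longrightarrow> g \<in> \<Gamma> \<rightarrow> A \<Longrightarrow> (\<lambda>u. f u \<otimes> g u) \<in> \<Gamma> \<rightarrow> A"
  by (simp add: Pi_iff)

lemma twisted_diff_in_A:
  "f \<in> \<Gamma> \<rightarrow> A \<Longrightarrow> x \<in> \<Gamma> \<Longrightarrow> twisted_diff m x f \<in> \<Gamma> \<rightarrow> A"
  by (simp add: twisted_diff_def Pi_iff)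

lemma annihilated_mult:
  assumes "f \<in> \<Gamma> \<rightarrow> A" "g \<in> \<Gamma> \<rightarrow> A" "annihilated ms f" "annihilated ms g"
  shows "annihilated ms (\<lambda>u. f u \<otimes> g u)"
  using assms
proof (induction ms arbitrary: f g)
  case (Cons m ms)
  have "annihilated ms (twisted_diff m x (\<lambda>u. f u \<otimes> g u))" if x: "x \<in> \<Gamma>" for x
  proof -
    have "annihilated ms (\<lambda>u. twisted_diff m x f u \<otimes> twisted_diff m x g u)"
      using Cons.prems x by (intro Cons.IH) (auto simp: twisted_diff_def Pi_iff)
    then show ?thesis
      by (rule annihilated_cong[THEN iffD1, rotated])
        (use Cons.prems(1,2) x in \<open>simp add: Pi_iff twisted_diff_def conj_by_mult A_div_mult\<close>)
  qed
  then show ?case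
    by simp
qed simp

lemma annihilated_inv:
  assumes "f \<in> \<Gamma> \<rightarrow> A" "annihilated ms f"
  shows "annihilated ms (\<lambda>u. inv (f u))"
  using assms
proof (induction ms arbitrary: f)
  case (Cons m ms)
  have "annihilated ms (twisted_diff m x (\<lambda>u. inv (f u)))" if x: "x \<in> \<Gamma>" for x
  proof -
    have "annihilated ms (\<lambda>u. inv (twisted_diff m x f u))"
      using Cons.prems x by (intro Cons.IH) (auto simp: twisted_diff_def Pi_iff)
    then show ?thesis
      by (rule annihilated_cong[THEN iffD1, rotated])
        (use Cons.prems(1) x in \<open>simp add: Pi_iff twisted_diff_def conj_by_inv inv_mult_A\<close>)
  qed
  then show ?case
    by simp
qed simp

lemma annihilated_conj_by:
  assumes "f \<in> \<Gamma> \<rightarrow> A" "g \<in> carrier G" "annihilated ms f"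
  shows "annihilated ms (\<lambda>u. conj_by g (f u))"
  using assms
proof (induction ms arbitrary: f)
  case (Cons m ms)
  have "annihilated ms (twisted_diff m x (\<lambda>u. conj_by g (f u)))" if x: "x \<in> \<Gamma>" for x
  proof -
    have "annihilated ms (\<lambda>u. conj_by g (twisted_diff m x f u))"
      using Cons.prems x by (intro Cons.IH) (auto simp: twisted_diff_def Pi_iff)
    then show ?thesis
      by (rule annihilated_cong[THEN iffD1, rotated])
        (use Cons.prems(1,2) x in \<open>simp add: Pi_iff twisted_diff_def conj_by_inv conj_by_mult
            conj_by_commute[of g]\<close>)
  qed
  then show ?case
    by simp
qed simp

text \<open>
  Left translations do not commute, but translating by \<open>y\<close> and then by \<open>x\<close> is translating by the
  conjugate \<open>x' = y x y\<inverse>\<close> and then by \<open>y\<close>, and characters do not distinguish \<open>x\<close> from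
  \<open>x'\<close>.
\<close>

lemma annihilated_shift:
  assumes "f \<in> \<Gamma> \<rightarrow> A" "y \<in> \<Gamma>" "annihilated ms f"
  shows "annihilated ms (\<lambda>u. f (shift y u))"
  using assms
proof (induction ms arbitrary: f)
  case (Cons m ms)
  have "annihilated ms (twisted_diff m x (\<lambda>u. f (shift y u)))" if x: "x \<in> \<Gamma>" for x
  proof -
    define x' where "x' = (\<lambda>i. y i \<otimes> x i \<otimes> inv (y i))"
    have x': "x' \<in> \<Gamma>"
      using x Cons.prems by (intro assignmentI) (simp add: x'_def)
    have swap: "shift x' y = shift y x"
      using x Cons.prems by (auto simp: x'_def shift_def m_assoc)
    have "conj_by (val m x') a = conj_by (val m x) a" if "a \<in> A" for a
    proof -
      let ?b = "conj_by (inv (val m y)) a"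
      have b: "?b \<in> A" "conj_by (val m y) ?b = a"
        using that Cons.prems by (simp_all add: conj_by_conj_by)
      have "conj_by (val m x') (conj_by (val m y) ?b) = conj_by (val m y) (conj_by (val m x) ?b)"
        using x' x Cons.prems b(1) swap
          conj_by_val_shift[of x' y ?b m] conj_by_val_shift[of y x ?b m] by simp
      then show ?thesis
        using x Cons.prems b conj_by_commute[of "val m y" "val m x" ?b] by simp
    qed
    then have "twisted_diff m x' f (shift y u) = twisted_diff m x (\<lambda>u. f (shift y u)) u" if "u \<in> \<Gamma>" for u
      using that x x' Cons.prems(1,2) swap
      by (simp add: Pi_iff twisted_diff_def shift_assoc[symmetric])
    moreover have "annihilated ms (\<lambda>u. twisted_diff m x' f (shift y u))"
      using Cons.prems x' by (intro Cons.IH) (auto simp: twisted_diff_def Pi_iff)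
    ultimately show ?thesis
      by (rule annihilated_cong[THEN iffD1])
  qed
  then show ?case
    by simp
qed simp

lemma annihilated_twisted_diff:
  assumes "f \<in> \<Gamma> \<rightarrow> A" "x \<in> \<Gamma>" "annihilated ms f"
  shows "annihilated ms (twisted_diff m x f)"
  unfolding twisted_diff_def using assms
  by (intro annihilated_mult annihilated_inv annihilated_shift annihilated_conj_by) (auto simp: Pi_iff)

lemma annihilated_append2:
  assumes "f \<in> \<Gamma> \<rightarrow> A" "annihilated ms' f"
  shows "annihilated (ms @ ms') f"
  using assms by (induction ms arbitrary: f) (simp_all add: annihilated_twisted_diff twisted_diff_in_A)

lemma annihilated_append1:
  assumes "f \<in> \<Gamma> \<rightarrow> A" "annihilated ms f"
  shows "annihilated (ms @ ms') f"
  using assms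
proof (induction ms arbitrary: f)
  case Nil
  then show ?case
    using annihilated_append2[of f "[]" ms'] by simp
qed (simp add: twisted_diff_in_A)

text \<open>
  Multiplying by the character of \<open>v\<close> shifts every frequency: the character of \<open>m\<close> becomes that
  of \<open>v @ m\<close>.
\<close>

lemma annihilated_char_mult:
  assumes "f \<in> \<Gamma> \<rightarrow> A" "annihilated ms f"
  shows "annihilated (map ((@) v) ms) (\<lambda>u. conj_by (val v u) (f u))"
  using assms
proof (induction ms arbitrary: f)
  case (Cons m ms)
  have "annihilated (map ((@) v) ms) (twisted_diff (v @ m) x (\<lambda>u. conj_by (val v u) (f u)))"
    if x: "x \<in> \<Gamma>" for x
  proof -
    have "conj_by (val v x) (conj_by (val v u) (twisted_diff m x f u))
        = twisted_diff (v @ m) x (\<lambda>u. conj_by (val v u) (f u)) u" if u: "u \<in> \<Gamma>" for u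
      using Cons.prems(1) x u conj_by_commute[of "val v u" "val m x" "f u"]
      by (simp add: Pi_iff twisted_diff_def conj_by_mult conj_by_inv conj_by_val_shift val_append
          flip: conj_by_conj_by)
    moreover have "annihilated (map ((@) v) ms) (\<lambda>u. conj_by (val v x) (conj_by (val v u) (twisted_diff m x f u)))"
      using Cons.prems x by (intro annihilated_conj_by Cons.IH) (auto simp: twisted_diff_def Pi_iff)
    ultimately show ?thesis
      by (rule annihilated_cong[THEN iffD1])
  qed
  then show ?case
    by simp
qed simp

lemma annihilated_monomial: "b \<in> A \<Longrightarrow> annihilated [v] (\<lambda>u. conj_by (val v u) b)"
  by (simp add: Pi_iff twisted_diff_def conj_by_val_shift)

text \<open>
  A commutator with a constant is a cocycle in the varying letter.  If the letter is a variable, its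
  value is multiplicative in the assignment, and a difference twisted by the letter leaves a constant;
  if it is an inverse, its value is antimultiplicative, and an untwisted difference leaves a monomial.
\<close>

lemma annihilated_commutator:
  fixes y :: letter
  assumes c: "c \<in> carrier G"
  shows "annihilated (if snd y then [[y], []] else [[], [y]])
     (\<lambda>u. letter_val G u y \<otimes> c \<otimes> inv (letter_val G u y) \<otimes> inv c)"
proof -
  let ?Y = "\<lambda>u. letter_val G u y"
  define h where "h u = ?Y u \<otimes> c \<otimes> inv (?Y u) \<otimes> inv c" for u
  have h: "h u \<in> A" if "u \<in> \<Gamma>" for u
    using that c by (simp add: h_def commutator_in_A)
  have "annihilated (if snd y then [[y], []] else [[], [y]]) h"
  proof (cases "snd y")
    case True
    have "annihilated [[]] (twisted_diff [y] x h)" if x: "x \<in> \<Gamma>" for x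
    proof -
      have "conj_by (val [] u) (h x) = twisted_diff [y] x h u" if u: "u \<in> \<Gamma>" for u
      proof -
        have "h (shift x u) = conj_by (?Y x) (h u) \<otimes> h x"
          using x u c True by (simp add: h_def conj_by_def letter_val_shift m_assoc inv_mult_group)
        then show ?thesis
          using x u h[of x] h[of u] A_commute[of "conj_by (?Y x) (h u)" "h x"]
          by (simp add: twisted_diff_def m_assoc)
      qed
      then show ?thesis
        by (rule annihilated_cong[THEN iffD1, OF _ annihilated_monomial[OF h[OF x]]])
    qed
    then show ?thesis
      using True by simp
  next
    case False
    have "annihilated [[y]] (twisted_diff [] x h)" if x: "x \<in> \<Gamma>" for x
    proof -
      have "conj_by (val [y] u) (h x) = twisted_diff [] x h u" if u: "u \<in> \<Gamma>" for u
        using x u c False h[of u]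
        by (simp add: twisted_diff_def) (simp add: h_def conj_by_def letter_val_shift m_assoc inv_mult_group)
      then show ?thesis
        by (rule annihilated_cong[THEN iffD1, OF _ annihilated_monomial[OF h[OF x]]])
    qed
    then show ?thesis
      using False by simp
  qed
  then show ?thesis
    unfolding h_def[abs_def] .
qed

text \<open>
  Each of the three factors in the recursion for the defect is an exponential polynomial, and such
  functions are closed under products and under multiplication by characters.
\<close>

lemma defect_annihilated:
  assumes x: "x \<in> \<Gamma>"
  shows "\<exists>ms. annihilated ms (defect w x)"
proof (induction w)
  case Nil
  show ?case
    using x by (intro exI[of _ "[]"]) (simp add: defect_def)
next
  case (Cons y w)
  then obtain ms where ms: "annihilated ms (defect w x)"
    by blast
  let ?Y = "\<lambda>v. letter_val G v y"
  let ?L = "if snd y then [[y], []] else [[], [y]]"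
  let ?f = "\<lambda>u. conj_by (?Y x) (conj_by (val [y] u) (defect w x u))"
  let ?g = "\<lambda>u. ?Y (shift x u) \<otimes> inv (?Y u) \<otimes> inv (?Y x)"
  let ?h = "\<lambda>u. conj_by (?Y x) (?Y u \<otimes> val w x \<otimes> inv (?Y u) \<otimes> inv (val w x))"
  have fA: "?f \<in> \<Gamma> \<rightarrow> A" and hA: "?h \<in> \<Gamma> \<rightarrow> A"
    using x defect_in_A commutator_in_A by (auto simp del: PiE)
  have g: "?g u = (if snd y then \<one> else ?Y u \<otimes> ?Y x \<otimes> inv (?Y u) \<otimes> inv (?Y x))" if "u \<in> \<Gamma>" for u
    using x that by (simp add: letter_val_shift m_assoc)
  have gA: "?g \<in> \<Gamma> \<rightarrow> A"
    using x by (intro funcsetI) (simp only: g, simp add: commutator_in_A)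
  have fgA: "(\<lambda>u. ?f u \<otimes> ?g u) \<in> \<Gamma> \<rightarrow> A"
    by (rule mult_funcset_A[OF fA gA])
  have "annihilated ?L ?g"
  proof (cases "snd y")
    case True
    have "annihilated [] ?g"
      using g True by simp
    then show ?thesis
      using annihilated_append1[OF gA, of "[]" ?L] by simp
  next
    case False
    then show ?thesis
      using annihilated_commutator[of "?Y x" y] x g
      by (subst annihilated_cong[OF g]) simp_all
  qed
  moreover have "annihilated (map ((@) [y]) ms) ?f"
    using x ms defect_in_A by (intro annihilated_conj_by annihilated_char_mult) auto
  moreover have "annihilated ?L ?h"
    using x commutator_in_A by (intro annihilated_conj_by annihilated_commutator) auto
  ultimately have "annihilated (map ((@) [y]) ms @ ?L) (\<lambda>u. ?f u \<otimes> ?g u \<otimes> ?h u)"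
    using fA gA hA fgA
      annihilated_append1[OF fA] annihilated_append2[OF gA] annihilated_append2[OF hA]
      annihilated_mult[OF fA gA] annihilated_mult[OF fgA hA]
    by blast
  moreover have "?f u \<otimes> ?g u \<otimes> ?h u = defect (y # w) x u" if u: "u \<in> \<Gamma>" for u
    using x u defect_in_A[OF x u] conj_by_val_shift[OF x u defect_in_A[OF x u], of "[y]"]
    by (simp add: defect_Cons)
  ultimately show ?case
    using annihilated_cong[of "\<lambda>u. ?f u \<otimes> ?g u \<otimes> ?h u" "defect (y # w) x"] by blast
qed

end

section \<open>Finitely many values\<close>

lemma finite_range_repeats:
  fixes s :: "nat \<Rightarrow> 'c"
  assumes "finite V" "range s \<subseteq> V"
  shows "\<exists>i j. i < j \<and> s i = s j"
proof -
  have "\<not> inj s"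
    using assms finite_subset finite_imageD infinite_UNIV_nat by metis
  then show ?thesis
    by (metis injI linorder_neqE_nat)
qed

context abelian_by_abelian
begin

definition Tor :: "'a set" where
  "Tor = {a \<in> A. \<exists>n>0::nat. a [^] n = \<one>}"

lemma Tor_in_A [simp]: "a \<in> Tor \<Longrightarrow> a \<in> A"
  by (simp add: Tor_def)

lemma one_in_Tor [simp]: "\<one> \<in> Tor"
  by (auto simp: Tor_def simp del: Tor_in_A)

lemma mult_in_Tor [simp]:
  assumes "a \<in> Tor" "b \<in> Tor"
  shows "a \<otimes> b \<in> Tor"
proof -
  obtain m n :: nat where mn: "m > 0" "n > 0" "a [^] m = \<one>" "b [^] n = \<one>"
    using assms by (auto simp: Tor_def simp del: Tor_in_A)
  have ab: "a \<in> A" "b \<in> A"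
    using assms by simp_all
  have "(a \<otimes> b) [^] (m * n) = a [^] (m * n) \<otimes> b [^] (n * m)"
    using ab A_commute by (simp add: pow_mult_distrib mult.commute)
  also have "\<dots> = \<one>"
    using ab mn by (simp flip: nat_pow_pow)
  finally show ?thesis
    using mn ab unfolding Tor_def by (auto intro!: exI[of _ "m * n"])
qed

lemma inv_in_Tor [simp]: "a \<in> Tor \<Longrightarrow> inv a \<in> Tor"
  by (auto simp: Tor_def nat_pow_inv simp del: Tor_in_A)

lemma conj_by_in_Tor [simp]: "g \<in> carrier G \<Longrightarrow> a \<in> Tor \<Longrightarrow> conj_by g a \<in> Tor"
  unfolding Tor_def by (auto simp flip: conj_by_pow)

lemma torsion_of_pow_in_Tor:
  assumes "a \<in> carrier G" "a [^] n \<in> Tor" "n > (0::nat)"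
  shows "\<exists>k>0::nat. a [^] k = \<one>"
proof -
  obtain m :: nat where "m > 0" "(a [^] n) [^] m = \<one>"
    using assms by (auto simp: Tor_def simp del: Tor_in_A)
  then show ?thesis
    using assms by (intro exI[of _ "n * m"]) (simp add: nat_pow_pow)
qed

text \<open>
  Congruence modulo the torsion of \<open>A\<close>, used in place of a quotient group so that word maps keep their
  values in \<open>G\<close>.
\<close>

definition tcong :: "'a \<Rightarrow> 'a \<Rightarrow> bool" (infix \<open>\<asymp>\<close> 50) where
  "x \<asymp> y \<longleftrightarrow> x \<in> carrier G \<and> y \<in> carrier G \<and> x \<otimes> inv y \<in> Tor"

lemma tcong_refl [simp]: "x \<in> carrier G \<Longrightarrow> x \<asymp> x"
  by (simp add: tcong_def)

lemma tcong_sym: "x \<asymp> y \<Longrightarrow> y \<asymp> x"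
  using inv_in_Tor[of "x \<otimes> inv y"] by (auto simp: tcong_def inv_mult_group simp del: inv_in_Tor)

lemma tcong_trans [trans]:
  assumes "x \<asymp> y" "y \<asymp> z"
  shows "x \<asymp> z"
proof -
  have "(x \<otimes> inv y) \<otimes> (y \<otimes> inv z) \<in> Tor"
    using assms unfolding tcong_def by (blast intro: mult_in_Tor)
  then show ?thesis
    using assms by (simp add: tcong_def m_assoc)
qed

lemma tcong_mult:
  assumes "x \<asymp> x'" "y \<asymp> y'"
  shows "x \<otimes> y \<asymp> x' \<otimes> y'"
proof -
  have "conj_by x (y \<otimes> inv y') \<otimes> (x \<otimes> inv x') \<in> Tor"
    using assms unfolding tcong_def by (blast intro: mult_in_Tor conj_by_in_Tor)
  then show ?thesis
    using assms by (simp add: tcong_def conj_by_def m_assoc inv_mult_group)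
qed

lemma tcong_conj_by:
  assumes "g \<in> carrier G" "x \<asymp> y"
  shows "conj_by g x \<asymp> conj_by g y"
  using assms conj_by_in_Tor[of g "x \<otimes> inv y"]
  by (simp add: tcong_def conj_by_mult conj_by_inv del: conj_by_in_Tor)

lemma tcong_inv:
  assumes "x \<asymp> y"
  shows "inv x \<asymp> inv y"
proof -
  have "conj_by (inv x) (inv (x \<otimes> inv y)) \<in> Tor"
    using assms unfolding tcong_def by (blast intro: inv_in_Tor conj_by_in_Tor inv_closed)
  then show ?thesis
    using assms tcong_sym[of "inv y" "inv x"]
    by (simp add: tcong_def conj_by_def m_assoc inv_mult_group)
qed

lemma tcong_in_Tor: "x \<asymp> y \<Longrightarrow> y \<in> Tor \<Longrightarrow> x \<in> Tor"
  using mult_in_Tor[of "x \<otimes> inv y" y] by (simp add: tcong_def m_assoc del: mult_in_Tor)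

lemma tcong_one_iff: "x \<in> carrier G \<Longrightarrow> x \<asymp> \<one> \<longleftrightarrow> x \<in> Tor"
  by (simp add: tcong_def)

lemma tcong_pow_eq_torsion:
  assumes "a \<in> carrier G" "b \<in> carrier G" "i < (j::nat)" "a [^] i \<otimes> b \<asymp> a [^] j \<otimes> b"
  shows "\<exists>k>0::nat. a [^] k = \<one>"
proof -
  have "a [^] j \<otimes> b \<otimes> inv (a [^] i \<otimes> b) \<in> Tor"
    using tcong_sym[OF assms(4)] by (simp add: tcong_def)
  also have "a [^] j \<otimes> b \<otimes> inv (a [^] i \<otimes> b) = a [^] j \<otimes> inv (a [^] i)"
    using assms by (simp add: m_assoc inv_mult_group)
  also have "a [^] j = a [^] (j - i) \<otimes> a [^] i"
    using assms by (simp add: nat_pow_mult)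
  also have "a [^] (j - i) \<otimes> a [^] i \<otimes> inv (a [^] i) = a [^] (j - i)"
    using assms by (simp add: m_assoc)
  finally show ?thesis
    using assms by (intro torsion_of_pow_in_Tor[of _ "j - i"]) simp_all
qed

lemma funpow_shift_closed: "x \<in> \<Gamma> \<Longrightarrow> u \<in> \<Gamma> \<Longrightarrow> (shift x ^^ j) u \<in> \<Gamma>"
  by (induction j) simp_all

text \<open>
  By induction the twisted difference \<open>F\<close> of \<open>f\<close> is invariant under the shift by \<open>x\<close>, modulo
  torsion, and there it is the ordinary difference.  So along \<open>u, xu, x\<^sup>2u, \<dots>\<close> the function
  \<open>f\<close> is an arithmetic progression with difference \<open>F u\<close>; having finitely many values, it must
  repeat one, which makes \<open>F u\<close> torsion.
\<close>

lemma annihilated_finite_invariant: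
  assumes H: "H \<subseteq> \<Gamma>"
    and f: "f \<in> \<Gamma> \<rightarrow> A" "finite (f ` \<Gamma>)" "annihilated ms f"
    and fixed: "\<And>m x u. x \<in> H \<Longrightarrow> u \<in> \<Gamma> \<Longrightarrow> conj_by (val m x) (f u) \<asymp> f u"
    and x: "x \<in> H" and u: "u \<in> \<Gamma>"
  shows "f (shift x u) \<asymp> f u"
  using f fixed x u
proof (induction ms arbitrary: f x u)
  case Nil
  then show ?case
    using H by auto
next
  case (Cons m ms)
  have x: "x \<in> \<Gamma>"
    using Cons.prems H by blast
  have fA: "f v \<in> A" if "v \<in> \<Gamma>" for v
    using that Cons.prems by blast
  define F where "F = twisted_diff m x f"
  have F_eq: "F v \<asymp> f (shift x v) \<otimes> inv (f v)" if "v \<in> \<Gamma>" for v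
    unfolding F_def twisted_diff_def
    using Cons.prems(4)[of x v m] Cons.prems that x fA
    by (intro tcong_mult tcong_inv) simp_all
  have FA: "F v \<in> A" if "v \<in> \<Gamma>" for v
    using that fA x by (simp add: F_def twisted_diff_def)
  have invariant: "F (shift x v) \<asymp> F v" if v: "v \<in> \<Gamma>" for v
  proof (rule Cons.IH)
    show "F \<in> \<Gamma> \<rightarrow> A"
      using FA by blast
    have "F ` \<Gamma> \<subseteq> (\<lambda>(a, b). a \<otimes> inv (conj_by (val m x) b)) ` (f ` \<Gamma> \<times> f ` \<Gamma>)"
      using x by (force simp: F_def twisted_diff_def)
    then show "finite (F ` \<Gamma>)"
      using Cons.prems(2) by (meson finite_SigmaI finite_imageI finite_subset)
    show "annihilated ms F"
      using Cons.prems(3) x by (simp add: F_def)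
    show "conj_by (val m' y) (F u') \<asymp> F u'" if "y \<in> H" "u' \<in> \<Gamma>" for m' y u'
    proof -
      have y: "y \<in> \<Gamma>"
        using that H by blast
      let ?g = "val m' y"
      have "conj_by ?g (F u') \<asymp> conj_by ?g (f (shift x u') \<otimes> inv (f u'))"
        using y that F_eq by (intro tcong_conj_by) simp_all
      also have "\<dots> = conj_by ?g (f (shift x u')) \<otimes> inv (conj_by ?g (f u'))"
        using y x that fA by (simp add: conj_by_mult conj_by_inv)
      also have "\<dots> \<asymp> f (shift x u') \<otimes> inv (f u')"
        using that x by (intro tcong_mult tcong_inv Cons.prems(4)) simp_all
      also have "\<dots> \<asymp> F u'"
        using tcong_sym F_eq that by blast
      finally show ?thesis .
    qed
  qed (use Cons.prems v in auto)
  define v where "v j = (shift x ^^ j) u" for j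
  have v: "v j \<in> \<Gamma>" for j
    using x Cons.prems funpow_shift_closed by (simp add: v_def)
  have Fv: "F (v j) \<asymp> F u" for j
  proof (induction j)
    case (Suc j)
    then show ?case
      using invariant[OF v, of j] tcong_trans by (simp add: v_def)
  qed (use FA Cons.prems in \<open>simp add: v_def\<close>)
  have fv: "f (v j) \<asymp> F u [^] j \<otimes> f u" for j
  proof (induction j)
    case (Suc j)
    have "f (v (Suc j)) = (f (shift x (v j)) \<otimes> inv (f (v j))) \<otimes> f (v j)"
      using v fA x by (simp add: v_def[of "Suc j"] flip: v_def) (simp add: m_assoc)
    also have "\<dots> \<asymp> F u \<otimes> (F u [^] j \<otimes> f u)"
      using tcong_trans[OF tcong_sym[OF F_eq[OF v]] Fv] Suc by (intro tcong_mult) 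
    also have "\<dots> = F u [^] Suc j \<otimes> f u"
      using FA fA Cons.prems(6) nat_pow_Suc2[of "F u" j] by (simp add: m_assoc del: nat_pow_Suc)
    finally show ?case .
  qed (use fA Cons.prems in \<open>simp add: v_def\<close>)
  obtain i j where ij: "i < j" "f (v i) = f (v j)"
    using finite_range_repeats[of "f ` \<Gamma>" "\<lambda>j. f (v j)"] Cons.prems(2) v by blast
  have "F u [^] i \<otimes> f u \<asymp> F u [^] j \<otimes> f u"
    using tcong_trans[OF tcong_sym[OF fv[of i]]] fv[of j] ij(2) by simp
  then have "F u \<in> Tor"
    using tcong_pow_eq_torsion[of "F u" "f u" i j] FA fA Cons.prems(6) ij(1) by (simp add: Tor_def del: Tor_in_A)
  then have "f (shift x u) \<otimes> inv (f u) \<in> Tor"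
    using tcong_in_Tor[OF tcong_sym[OF F_eq]] Cons.prems(6) by blast
  then show ?case
    using fA x Cons.prems(6) by (simp add: tcong_def)
qed

text \<open>
  Modulo torsion \<open>w\<close> takes the powers of \<open>x\<close> to the powers of \<open>w(x)\<close>, two of which must
  coincide.
\<close>

lemma torsion_value_of_additive:
  assumes H: "H \<subseteq> \<Gamma>" "\<And>x y. x \<in> H \<Longrightarrow> y \<in> H \<Longrightarrow> shift x y \<in> H"
    and fin: "finite (val w ` \<Gamma>)"
    and additive: "\<And>x y. x \<in> H \<Longrightarrow> y \<in> H \<Longrightarrow> defect w x y \<in> Tor"
    and x: "x \<in> H"
  shows "\<exists>n>0::nat. val w x [^] n = \<one>"
proof -
  define p where "p j = (shift x ^^ j) x" for j
  have p: "p j \<in> H" for j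
    by (induction j) (simp_all add: p_def x H)
  have xG: "x \<in> \<Gamma>" and pG: "p j \<in> \<Gamma>" for j
    using x p H by auto
  have val_p: "val w (p j) \<asymp> val w x [^] j \<otimes> val w x" for j
  proof (induction j)
    case (Suc j)
    have "val w (p (Suc j)) = defect w x (p j) \<otimes> (val w x \<otimes> val w (p j))"
      using xG pG[of j] val_shift[of x "p j" w] by (simp add: p_def[of "Suc j"] m_assoc flip: p_def)
    also have "\<dots> \<asymp> \<one> \<otimes> (val w x \<otimes> (val w x [^] j \<otimes> val w x))"
      using xG pG[of j] additive[OF x p] Suc by (intro tcong_mult) (simp_all add: tcong_one_iff)
    also have "\<dots> = val w x [^] Suc j \<otimes> val w x"
      using xG nat_pow_Suc2[of "val w x" j] by (simp add: m_assoc del: nat_pow_Suc)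
    finally show ?case .
  qed (use xG in \<open>simp add: p_def\<close>)
  obtain i j where ij: "i < j" "val w (p i) = val w (p j)"
    using finite_range_repeats[of "val w ` \<Gamma>" "\<lambda>j. val w (p j)"] fin pG by blast
  have "val w x [^] i \<otimes> val w x \<asymp> val w x [^] j \<otimes> val w x"
    using tcong_trans[OF tcong_sym[OF val_p[of i]]] val_p[of j] ij(2) by simp
  then show ?thesis
    using tcong_pow_eq_torsion[of "val w x" "val w x" i j] xG ij(1) by simp
qed

lemma val_one: "val w (\<lambda>_. \<one>) = \<one>"
  by (induction w) (simp_all add: letter_val_def)

lemma one_assignment: "(\<lambda>_. \<one>) \<in> \<Gamma>"
  by (rule assignmentI) simp

lemma shift_one: "x \<in> \<Gamma> \<Longrightarrow> shift x (\<lambda>_. \<one>) = x"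
  by (simp add: shift_def)

lemma defect_one: "x \<in> \<Gamma> \<Longrightarrow> defect w x (\<lambda>_. \<one>) = \<one>"
  by (simp add: defect_def shift_one val_one)

lemma val_in_A: "(\<And>i. a i \<in> A) \<Longrightarrow> val w a \<in> A"
  by (induction w) (simp_all add: letter_val_def)

text \<open>
  The invariance lemma is applied to the defects, first with the shifts \<open>H\<close> by assignments in \<open>A\<close>
  and then, once the values of \<open>w\<close> are known to be central modulo torsion, with all shifts.
\<close>

theorem finitely_many_values_torsion:
  assumes fin: "finite (val w ` \<Gamma>)" and g: "g \<in> \<Gamma>"
  shows "\<exists>n>0::nat. val w g [^] n = \<one>"
proof -
  define H where "H = (UNIV \<rightarrow> A :: (nat \<Rightarrow> 'a) set)"
  have H: "H \<subseteq> \<Gamma>" "\<And>x y. x \<in> H \<Longrightarrow> y \<in> H \<Longrightarrow> shift x y \<in> H"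
    by (auto simp: H_def shift_def Pi_iff intro!: assignmentI)
  have val_H: "val m a \<in> A" if "a \<in> H" for m a
    using that by (intro val_in_A) (auto simp: H_def)
  have defect_fun: "defect w x \<in> \<Gamma> \<rightarrow> A" and fin_defect: "finite (defect w x ` \<Gamma>)" if "x \<in> \<Gamma>" for x
  proof -
    show "defect w x \<in> \<Gamma> \<rightarrow> A"
      using that defect_in_A by blast
    have "defect w x ` \<Gamma> \<subseteq> (\<lambda>(a, b). a \<otimes> inv b \<otimes> inv (val w x)) ` (val w ` \<Gamma> \<times> val w ` \<Gamma>)"
      using that by (force simp: defect_def)
    then show "finite (defect w x ` \<Gamma>)"
      using fin by (meson finite_SigmaI finite_imageI finite_subset)
  qed
  \<comment> \<open>Invariance is used at the trivial assignment only, where the defect vanishes.\<close>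
  have defect_Tor: "defect w x y \<in> Tor"
    if x: "x \<in> \<Gamma>" and y: "y \<in> K" and K: "K \<subseteq> \<Gamma>"
      and fixed: "\<And>m y u. y \<in> K \<Longrightarrow> u \<in> \<Gamma> \<Longrightarrow> conj_by (val m y) (defect w x u) \<asymp> defect w x u"
    for x y K
  proof -
    obtain ms where "annihilated ms (defect w x)"
      using defect_annihilated[OF x] by blast
    then have "defect w x (shift y (\<lambda>_. \<one>)) \<asymp> defect w x (\<lambda>_. \<one>)"
      using annihilated_finite_invariant[OF K defect_fun[OF x] fin_defect[OF x] _ fixed y one_assignment]
      by blast
    then show ?thesis
      using x y K by (simp add: shift_one defect_one subset_iff tcong_one_iff)
  qed
  have defect_H: "defect w x a \<in> Tor" if x: "x \<in> \<Gamma>" and a: "a \<in> H" for x a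
  proof (rule defect_Tor[OF x a H(1)])
    fix m y u assume "y \<in> H" "u \<in> \<Gamma>"
    then show "conj_by (val m y) (defect w x u) \<asymp> defect w x u"
      using x defect_in_A[of x u w] val_H[of y m] conj_by_mod_A[of "val m y" "\<one>" "defect w x u"] by simp
  qed
  have val_Tor: "val w a \<in> Tor" if "a \<in> H" for a
    using that torsion_value_of_additive[OF H fin defect_H that] H(1) val_H
    by (auto simp: Tor_def simp del: Tor_in_A)
  have central: "conj_by h (val w x) \<asymp> val w x" if x: "x \<in> \<Gamma>" and h: "h \<in> carrier G" for x h
  proof -
    \<comment> \<open>The commutator by which right multiplication turns \<open>x\<close> into its conjugate.\<close>
    define a where "a i = inv (x i) \<otimes> h \<otimes> x i \<otimes> inv h" for i
    have aH: "a \<in> H"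
      using x h commutator_in_A[of "inv (x i)" h for i] by (auto simp: a_def H_def)
    have "(\<lambda>i. conj_by h (x i)) = shift x a"
      using x h by (simp add: shift_def a_def m_assoc conj_by_def)
    then have "conj_by h (val w x) = val w (shift x a)"
      using conj_by_val[OF h x, of w] by simp
    also have "\<dots> = defect w x a \<otimes> (val w x \<otimes> val w a)"
      using x aH H by (simp add: val_shift m_assoc subset_iff)
    also have "\<dots> \<asymp> \<one> \<otimes> (val w x \<otimes> \<one>)"
      using x defect_H[OF x aH] val_Tor[OF aH] by (intro tcong_mult) (simp_all add: tcong_one_iff)
    finally show ?thesis
      using x by simp
  qed
  have defect_all: "defect w x y \<in> Tor" if x: "x \<in> \<Gamma>" and y: "y \<in> \<Gamma>" for x y
  proof (rule defect_Tor[OF x y order_refl])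
    fix m y u assume "y \<in> \<Gamma>" "u \<in> \<Gamma>"
    then show "conj_by (val m y) (defect w x u) \<asymp> defect w x u"
      using x central unfolding defect_def
      by (simp add: conj_by_mult conj_by_inv tcong_mult tcong_inv)
  qed
  show ?thesis
    by (rule torsion_value_of_additive[OF order_refl _ fin defect_all g]) simp_all
qed

theorem finitely_many_values_finite_verbal:
  assumes "finite (val w ` \<Gamma>)"
  shows "finite (generate G (val w ` \<Gamma>))"
proof (rule Dietzmann[OF assms])
  fix g v assume g: "g \<in> carrier G" and "v \<in> val w ` \<Gamma>"
  then obtain u where u: "u \<in> \<Gamma>" "v = val w u"
    by blast
  then have "(\<lambda>i. conj_by g (u i)) \<in> \<Gamma>"
    using g by (intro assignmentI) simp
  then show "conj_by g v \<in> val w ` \<Gamma>"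
    using conj_by_val[OF g u(1), of w] u(2) by (metis imageI)
qed (use finitely_many_values_torsion[OF assms] in auto)

end

section \<open>Locally constant functions\<close>

definition locally_constant_at :: "'c topology \<Rightarrow> ('c \<Rightarrow> 'd) \<Rightarrow> 'c \<Rightarrow> bool" where
  "locally_constant_at K f p \<longleftrightarrow> (\<exists>U. openin K U \<and> p \<in> U \<and> (\<forall>u\<in>U. f u = f p))"

abbreviation small :: "'c set \<Rightarrow> bool" where
  "small V \<equiv> V \<prec> (UNIV :: nat set set)"

lemma small_image_Times:
  assumes "small V" "W \<subseteq> g ` (V \<times> V)"
  shows "small W"
proof -
  have "small (V \<times> V)"
  proof (cases "finite V")
    case True
    then show ?thesis
      using finite_lesspoll_infinite[of "UNIV :: nat set set" "V \<times> V"] by (simp add: Finite_Set.finite_set)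
  next
    case False
    then have "V \<times> V \<approx> V"
      using card_of_Times_same_infinite[of V] by (simp add: eqpoll_iff_card_of_ordIso)
    then show ?thesis
      using assms(1) eq_lesspoll_trans by blast
  qed
  moreover have "W \<lesssim> V \<times> V"
    using assms(2) by (meson image_lepoll lepoll_trans subset_imp_lepoll)
  ultimately show ?thesis
    by (rule lesspoll_trans1[rotated])
qed

text \<open>
  The image is a compact Hausdorff space.  If no point of it were isolated, it would be a perfect set
  and have at least as many points as the real line.  The preimage of an isolated point is open.
\<close>

lemma small_image_locally_constant_at:
  assumes K: "compact_space K" "topspace K \<noteq> {}" and L: "Hausdorff_space L"
    and f: "continuous_map K L f" and small: "small (f ` topspace K)"
  shows "\<exists>p\<in>topspace K. locally_constant_at K f p"
proof -
  let ?V = "f ` topspace K"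
  have V: "compactin L ?V"
    using K f by (meson compact_space_def image_compactin)
  then have closed: "closedin L ?V"
    using L compactin_imp_closedin by blast
  have VL: "?V \<subseteq> topspace L"
    using V compactin_subset_topspace by blast
  have "L derived_set_of ?V \<noteq> ?V"
  proof
    assume eq: "L derived_set_of ?V = ?V"
    let ?S = "subtopology L ?V"
    have "compact_space ?S" "Hausdorff_space ?S"
      using V L by (auto simp: compact_space_subtopology Hausdorff_space_subtopology)
    moreover have "?S derived_set_of ?V = ?V"
      using eq by (simp add: derived_set_of_subtopology)
    ultimately have "(UNIV :: real set) \<lesssim> ?V"
      using K(2) by (intro lepoll_perfect_set[of ?S])
        (auto simp: compact_imp_locally_compact_space)
    then have "(UNIV :: nat set set) \<lesssim> ?V"
      using nat_sets_eqpoll_reals by (meson eqpoll_imp_lepoll lepoll_trans)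
    then show False
      using small by (meson lesspoll_def lepoll_antisym)
  qed
  moreover have "L derived_set_of ?V \<subseteq> ?V"
    using closed by (simp add: closedin_contains_derived_set)
  ultimately obtain p where p: "p \<in> topspace K" "f p \<notin> L derived_set_of ?V"
    by blast
  then obtain N where N: "openin L N" "f p \<in> N" "\<And>y. y \<in> ?V \<Longrightarrow> y \<in> N \<Longrightarrow> y = f p"
    using VL by (auto simp: in_derived_set_of)
  then show ?thesis
    using p openin_continuous_map_preimage[OF f N(1)]
    unfolding locally_constant_at_def by (intro bexI[of _ p] exI[of _ "{x \<in> topspace K. f x \<in> N}"]) auto
qed

lemma locally_constant_finite_image:
  assumes "compact_space K" "\<And>p. p \<in> topspace K \<Longrightarrow> locally_constant_at K f p"
  shows "finite (f ` topspace K)"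
proof -
  obtain U where U: "\<And>p. p \<in> topspace K \<Longrightarrow> openin K (U p) \<and> p \<in> U p \<and> (\<forall>u\<in>U p. f u = f p)"
    using assms(2) unfolding locally_constant_at_def by metis
  have "\<forall>V\<in>U ` topspace K. openin K V" "topspace K \<subseteq> \<Union>(U ` topspace K)"
    using U by blast+
  then obtain \<F> where \<F>: "finite \<F>" "\<F> \<subseteq> U ` topspace K" "topspace K \<subseteq> \<Union>\<F>"
    using assms(1)[unfolded compact_space_alt, rule_format, of "U ` topspace K"] by blast
  then obtain P where P: "finite P" "P \<subseteq> topspace K" "\<F> = U ` P"
    by (meson finite_subset_image)
  have "f u \<in> f ` P" if "u \<in> topspace K" for u
  proof -
    have "u \<in> \<Union>(U ` P)"
      using that \<F>(3) P(3) by auto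
    then obtain p where "p \<in> P" "u \<in> U p"
      by (rule UN_E)
    then show ?thesis
      using U[of p] P(2) by auto
  qed
  then have "f ` topspace K \<subseteq> f ` P"
    by (rule image_subsetI)
  then show ?thesis
    using P(1) finite_subset by blast
qed

context topological_group
begin

abbreviation assignment_topology :: "(nat \<Rightarrow> 'a) topology" where
  "assignment_topology \<equiv> product_topology (\<lambda>_. T) UNIV"

lemma topspace_assignment_topology: "topspace assignment_topology = \<Gamma>"
  by (simp add: topspace_eq assignments_def PiE_UNIV_domain)

lemma continuous_map_mult:
  assumes "continuous_map K T f" "continuous_map K T g"
  shows "continuous_map K T (\<lambda>u. f u \<otimes> g u)"
proof -
  have "continuous_map K T ((\<lambda>(x, y). x \<otimes> y) \<circ> (\<lambda>u. (f u, g u)))"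
    using assms by (intro continuous_map_compose[OF _ continuous_mult] continuous_map_pairedI)
  then show ?thesis
    by (simp add: o_def)
qed

lemma continuous_map_inverse: "continuous_map K T f \<Longrightarrow> continuous_map K T (\<lambda>u. inv (f u))"
  using continuous_map_compose[OF _ continuous_inv] by (simp add: o_def)

lemma continuous_map_constant: "g \<in> carrier G \<Longrightarrow> continuous_map K T (\<lambda>_. g)"
  by (simp add: topspace_eq)

lemma continuous_map_conj_by:
  "g \<in> carrier G \<Longrightarrow> continuous_map K T f \<Longrightarrow> continuous_map K T (\<lambda>u. conj_by g (f u))"
  unfolding conj_by_def by (intro continuous_map_mult continuous_map_constant) auto

lemma continuous_map_assignment: "continuous_map assignment_topology T (\<lambda>u. u i)"
  by (rule continuous_map_product_projection) simp

lemma continuous_map_val: "continuous_map assignment_topology T (val w)"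
proof (induction w)
  case Nil
  then show ?case
    using continuous_map_constant[of \<one>] by (simp add: word_map_def)
next
  case (Cons y w)
  have "continuous_map assignment_topology T (\<lambda>u. letter_val G u y)"
    by (cases "snd y") (simp_all add: letter_val_def continuous_map_assignment continuous_map_inverse)
  with Cons show ?case
    using continuous_map_mult by simp
qed

lemma continuous_map_shift:
  "x \<in> \<Gamma> \<Longrightarrow> continuous_map assignment_topology assignment_topology (shift x)"
  unfolding continuous_map_componentwise_UNIV shift_def
  by (intro allI continuous_map_mult continuous_map_constant continuous_map_assignment) simp

text \<open>
  Translation by \<open>x = p g\<inverse>\<close> takes \<open>g\<close> to \<open>p\<close>, and near \<open>g\<close> both \<open>F\<close> and
  \<open>f\<close> are constant.
\<close>

lemma locally_constant_spreads:
  fixes f :: "(nat \<Rightarrow> 'a) \<Rightarrow> 'a"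
  assumes g: "g \<in> \<Gamma>" "locally_constant_at assignment_topology f g"
    and diff: "\<And>x. x \<in> \<Gamma> \<Longrightarrow>
      \<exists>(F :: (nat \<Rightarrow> 'a) \<Rightarrow> 'a) h. locally_constant_at assignment_topology F g
        \<and> (\<forall>u\<in>\<Gamma>. f (shift x u) = h (F u) (f u))"
    and p: "p \<in> \<Gamma>"
  shows "locally_constant_at assignment_topology f p"
proof -
  define x where "x i = p i \<otimes> inv (g i)" for i
  define x' where "x' i = g i \<otimes> inv (p i)" for i
  have x: "x \<in> \<Gamma>" "x' \<in> \<Gamma>"
    using g p by (auto intro!: assignmentI simp: x_def x'_def)
  obtain F :: "(nat \<Rightarrow> 'a) \<Rightarrow> 'a" and h where F: "locally_constant_at assignment_topology F g"
    and h: "\<And>u. u \<in> \<Gamma> \<Longrightarrow> f (shift x u) = h (F u) (f u)"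
    using diff[OF x(1)] by blast
  obtain U where U: "openin assignment_topology U" "g \<in> U" "\<And>u. u \<in> U \<Longrightarrow> f u = f g"
    using g(2) unfolding locally_constant_at_def by blast
  obtain U' where U': "openin assignment_topology U'" "g \<in> U'" "\<And>u. u \<in> U' \<Longrightarrow> F u = F g"
    using F unfolding locally_constant_at_def by blast
  define N where "N = {v \<in> topspace assignment_topology. shift x' v \<in> U \<inter> U'}"
  have "openin assignment_topology N"
    unfolding N_def using U(1) U'(1) x(2)
    by (intro openin_continuous_map_preimage[OF continuous_map_shift] openin_Int)
  moreover have "shift x' p = g" "shift x g = p"
    using g(1) p by (simp_all add: x_def x'_def shift_def m_assoc)
  then have "p \<in> N" and fp: "f p = h (F g) (f g)"
    using p U(2) U'(2) h[OF g(1)] unfolding N_def topspace_assignment_topology by auto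
  moreover have "f v = f p" if "v \<in> N" for v
  proof -
    have v: "v \<in> \<Gamma>" "shift x' v \<in> U" "shift x' v \<in> U'"
      using that unfolding N_def topspace_assignment_topology by auto
    have "shift x (shift x' v) = v"
      using v(1) g(1) p by (simp add: x_def x'_def shift_def m_assoc)
    then show ?thesis
      using h[of "shift x' v"] v x U(3) U'(3) fp by simp
  qed
  ultimately show ?thesis
    unfolding locally_constant_at_def by blast
qed

end

locale compact_abelian_by_abelian =
  abelian_by_abelian G A + topological_group G T
  for G :: "('a, 'b) monoid_scheme" (structure) and A T +
  assumes compact_T: "compact_space T" and Hausdorff_T: "Hausdorff_space T"
begin

lemma compact_assignment_topology: "compact_space assignment_topology"
  using compact_T by (simp add: compact_space_product_topology)

lemma small_image_locally_constant_somewhere: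
  assumes "continuous_map assignment_topology T f" "small (f ` \<Gamma>)"
  shows "\<exists>p\<in>\<Gamma>. locally_constant_at assignment_topology f p"
proof -
  have "\<Gamma> \<noteq> {}"
    using one_assignment by blast
  then show ?thesis
    using small_image_locally_constant_at[OF compact_assignment_topology _ Hausdorff_T assms(1)] assms(2)
    unfolding topspace_assignment_topology by blast
qed

text \<open>
  A twisted difference of \<open>f\<close> also has few values, as each is determined by two values of \<open>f\<close>, and
  it satisfies one condition less; so it is locally constant, and the one point where \<open>f\<close> is locally
  constant spreads.
\<close>

lemma annihilated_small_locally_constant:
  assumes "f \<in> \<Gamma> \<rightarrow> A" "annihilated ms f"
    "continuous_map assignment_topology T f" "small (f ` \<Gamma>)" "p \<in> \<Gamma>"
  shows "locally_constant_at assignment_topology f p"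
  using assms
proof (induction ms arbitrary: f p)
  case Nil
  then show ?case
    using openin_topspace[of assignment_topology]
    unfolding locally_constant_at_def topspace_assignment_topology by (intro exI[of _ \<Gamma>]) simp
next
  case (Cons m ms)
  obtain g where g: "g \<in> \<Gamma>" "locally_constant_at assignment_topology f g"
    using small_image_locally_constant_somewhere Cons.prems by blast
  show ?case
  proof (rule locally_constant_spreads[OF g _ Cons.prems(5)])
    fix x assume x: "x \<in> \<Gamma>"
    let ?F = "twisted_diff m x f"
    have "locally_constant_at assignment_topology ?F g"
    proof (rule Cons.IH[OF _ _ _ _ g(1)])
      show "?F \<in> \<Gamma> \<rightarrow> A"
        using Cons.prems(1) x by (rule twisted_diff_in_A)
      show "annihilated ms ?F"
        using Cons.prems(2) x by simp
      have "continuous_map assignment_topology T (f \<circ> shift x)"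
        using continuous_map_compose[OF continuous_map_shift[OF x] Cons.prems(3)] .
      then show "continuous_map assignment_topology T ?F"
        unfolding twisted_diff_def o_def using x Cons.prems(3)
        by (intro continuous_map_mult continuous_map_inverse continuous_map_conj_by) simp_all
      have "?F ` \<Gamma> \<subseteq> (\<lambda>(a, b). a \<otimes> inv (conj_by (val m x) b)) ` (f ` \<Gamma> \<times> f ` \<Gamma>)"
        using x by (force simp: twisted_diff_def)
      then show "small (?F ` \<Gamma>)"
        using small_image_Times[OF Cons.prems(4)] by blast
    qed
    moreover have "f (shift x u) = ?F u \<otimes> conj_by (val m x) (f u)" if "u \<in> \<Gamma>" for u
      using that x Cons.prems(1) by (simp add: twisted_diff_def Pi_iff m_assoc)
    ultimately show "\<exists>(F :: (nat \<Rightarrow> 'a) \<Rightarrow> 'a) h. locally_constant_at assignment_topology F g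
        \<and> (\<forall>u\<in>\<Gamma>. f (shift x u) = h (F u) (f u))"
      by (intro exI[of _ ?F] exI[of _ "\<lambda>a b. a \<otimes> conj_by (val m x) b"]) simp
  qed
qed

text \<open>
  The word map need not have its values in \<open>A\<close>, but the defects do; they play the part that
  the twisted differences play for functions into \<open>A\<close>.
\<close>

theorem small_values_finite:
  assumes small: "small (val w ` \<Gamma>)"
  shows "finite (val w ` \<Gamma>)"
proof -
  obtain g where g: "g \<in> \<Gamma>" "locally_constant_at assignment_topology (val w) g"
    using small_image_locally_constant_somewhere[OF continuous_map_val small] by blast
  have "locally_constant_at assignment_topology (val w) p" if "p \<in> \<Gamma>" for p
  proof (rule locally_constant_spreads[OF g _ that])
    fix x assume x: "x \<in> \<Gamma>"
    obtain ms where ms: "annihilated ms (defect w x)"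
      using defect_annihilated[OF x] by blast
    have "continuous_map assignment_topology T (val w \<circ> shift x)"
      using continuous_map_compose[OF continuous_map_shift[OF x] continuous_map_val] .
    then have cont: "continuous_map assignment_topology T (defect w x)"
      unfolding defect_def[abs_def] o_def using x
      by (intro continuous_map_mult continuous_map_inverse continuous_map_val continuous_map_constant) simp_all
    have "defect w x ` \<Gamma> \<subseteq> (\<lambda>(a, b). a \<otimes> inv b \<otimes> inv (val w x)) ` (val w ` \<Gamma> \<times> val w ` \<Gamma>)"
      using x by (force simp: defect_def)
    then have "small (defect w x ` \<Gamma>)"
      by (rule small_image_Times[OF small])
    then have "locally_constant_at assignment_topology (defect w x) g"
      using x ms cont g(1) defect_in_A by (intro annihilated_small_locally_constant) auto
    then show "\<exists>(F :: (nat \<Rightarrow> 'a) \<Rightarrow> 'a) h. locally_constant_at assignment_topology F g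
        \<and> (\<forall>u\<in>\<Gamma>. val w (shift x u) = h (F u) (val w u))"
      using x by (intro exI[of _ "defect w x"] exI[of _ "\<lambda>a b. a \<otimes> val w x \<otimes> b"]) (simp add: val_shift)
  qed
  then show ?thesis
    using locally_constant_finite_image[OF compact_assignment_topology, of "val w"]
    unfolding topspace_assignment_topology by blast
qed

end

section \<open>Strong conciseness\<close>

lemma (in group) word_values_eq:
  assumes "\<forall>a\<in>set w. fst a < k"
  shows "word_values G k w = val w ` \<Gamma>"
proof -
  have cong: "val w u = val w v" if "\<And>i. i < k \<Longrightarrow> u i = v i" for u v
    using assms that by (induction w) (simp_all add: letter_val_def)
  show ?thesis
  proof (intro equalityI subsetI)
    fix g assume "g \<in> word_values G k w"
    then obtain u where u: "u \<in> {..<k} \<rightarrow>\<^sub>E carrier G" "g = val w u"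
      by (auto simp: word_values_def)
    let ?v = "\<lambda>i. if i < k then u i else \<one>"
    have "?v \<in> \<Gamma>"
      using u by (intro assignmentI) auto
    moreover have "g = val w ?v"
      using u cong[of u ?v] by simp
    ultimately show "g \<in> val w ` \<Gamma>"
      by blast
  next
    fix g assume "g \<in> val w ` \<Gamma>"
    then obtain u where u: "u \<in> \<Gamma>" "g = val w u"
      by blast
    moreover have "restrict u {..<k} \<in> {..<k} \<rightarrow>\<^sub>E carrier G"
      using u by auto
    moreover have "g = val w (restrict u {..<k})"
      using u cong[of u "restrict u {..<k}"] by simp
    ultimately show "g \<in> word_values G k w"
      unfolding word_values_def by blast
  qed
qed

lemma metabelian_imp_abelian_by_abelian:
  assumes "metabelian G"
  shows "abelian_by_abelian G (derived G (carrier G))"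
proof -
  interpret group G
    using assms by (simp add: metabelian_def)
  let ?A = "derived G (carrier G)"
  have A: "?A \<subseteq> carrier G"
    by (rule derived_in_carrier) simp
  have comm: "g \<otimes>\<^bsub>G\<^esub> h \<otimes>\<^bsub>G\<^esub> inv\<^bsub>G\<^esub> g \<otimes>\<^bsub>G\<^esub> inv\<^bsub>G\<^esub> h \<in> derived G K" if "g \<in> K" "h \<in> K" for g h K
    unfolding derived_def using that by (intro generate.incl) blast
  have commute: "a \<otimes>\<^bsub>G\<^esub> b = b \<otimes>\<^bsub>G\<^esub> a" if ab: "a \<in> ?A" "b \<in> ?A" for a b
  proof -
    have G: "a \<in> carrier G" "b \<in> carrier G"
      using ab A by auto
    have "a \<otimes>\<^bsub>G\<^esub> b \<otimes>\<^bsub>G\<^esub> inv\<^bsub>G\<^esub> (b \<otimes>\<^bsub>G\<^esub> a) = \<one>\<^bsub>G\<^esub>"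
      using comm[OF ab] G assms by (simp add: metabelian_def m_assoc inv_mult_group)
    then show ?thesis
      using G by (metis inv_equality inv_inv inv_closed m_closed)
  qed
  show ?thesis
  proof (intro abelian_by_abelian.intro abelian_by_abelian_axioms.intro)
    show "?A \<lhd> G"
      by (rule derived_self_is_normal)
  qed (use commute comm is_group in blast)+
qed

theorem theorem1p1:
  fixes G :: "('a, 'b) monoid_scheme" and T :: "'a topology"
    and k :: nat and w :: "letter list"
  assumes "k \<ge> 1"
    and "w \<in> carrier (free_group k)"
    and "profinite_group G T"
    and "metabelian G"
    and "word_values G k w \<prec> (UNIV :: nat set set)"
  shows "finite (verbal_subgroup G T k w)"
proof -
  interpret profinite_group G T
    by fact
  interpret abelian_by_abelian G "derived G (carrier G)"
    using assms(4) by (rule metabelian_imp_abelian_by_abelian)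
  interpret compact_abelian_by_abelian G "derived G (carrier G)" T
    by unfold_locales (rule compact hausdorff)+
  have values_eq: "word_values G k w = val w ` \<Gamma>"
    using assms(2) by (intro word_values_eq) (simp add: free_group_def)
  have V: "val w ` \<Gamma> \<subseteq> carrier G"
    by auto
  have "finite (val w ` \<Gamma>)"
    using assms(5) by (intro small_values_finite) (simp add: values_eq)
  then have fin: "finite (generate G (val w ` \<Gamma>))"
    by (rule finitely_many_values_finite_verbal)
  have "closedin T (generate G (val w ` \<Gamma>))"
    using fin hausdorff generate_incl[OF V] by (intro closedin_Hausdorff_finite) (simp_all add: topspace_eq)
  then have "verbal_subgroup G T k w \<subseteq> generate G (val w ` \<Gamma>)"
    using generate_is_subgroup[OF V] generate.incl[of _ "val w ` \<Gamma>" G]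
    unfolding verbal_subgroup_def closed_subgroup_generated_def values_eq by blast
  then show ?thesis
    using fin finite_subset by blast
qed

end
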